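(* Suppose that for every prime $p$ and every integer $k\geq 1$ one has $\pi(p^{k+1};p,p-1)\geq k$. Then for every $n\geq 2$ the number $b_n$ is either $1$ or the largest prime factor of $n$. Hence, under this hypothesis, for every $n\ge 2$ the number $b_n$ is either $1$ or a prime number.
   Context: The sequence $(a_n)_{n\ge 1}$ of positive integers is defined by $a_1=1$ and $a_n=a_{n-1}+\operatorname{lcm}(n,a_{n-1})$ for $n\geq 2$. Each $a_{n}$ is a multiple of $a_{n-1}$, and one sets $b_n=\frac{a_n}{a_{n-1}}-1$ for $n\geq 2$, which is a positive integer. For integers $1\le a\le q$, $\pi(x;q,a)$ denotes the number of primes that are (strictly) less than $x$ and congruent to $a$ modulo $q$. *)

theory Defs
  imports "HOL-Number_Theory.Number_Theory"
begin

(* The sequence starts at index 1; the value at 0 is a dummy and is never used by later values. *)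
fun a_seq :: "nat \<Rightarrow> nat" where
  "a_seq 0 = 0"
| "a_seq (Suc 0) = 1"
| "a_seq (Suc (Suc n)) = a_seq (Suc n) + lcm (Suc (Suc n)) (a_seq (Suc n))"

(* Meaningful for n \<ge> 2.  There the division is exact and the subtraction does not truncate:
   see b_seq_of_nat below. *)
definition b_seq :: "nat \<Rightarrow> nat" where
  "b_seq n = a_seq n div a_seq (n - 1) - 1"

definition prime_count_ap :: "nat \<Rightarrow> nat \<Rightarrow> nat \<Rightarrow> nat" where
  "prime_count_ap x q a = card {p. prime p \<and> p < x \<and> [p = a] (mod q)}"

lemma a_seq_rec:
  assumes "n \<ge> 2"
  shows "a_seq n = a_seq (n - 1) + lcm n (a_seq (n - 1))"
proof -
  obtain m where "n = Suc (Suc m)"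
    using assms by (metis add_2_eq_Suc le_Suc_ex)
  then show ?thesis by simp
qed

lemma a_seq_pos: "n \<ge> 1 \<Longrightarrow> a_seq n > 0"
  by (induction n rule: a_seq.induct) auto

lemma a_seq_dvd:
  assumes "n \<ge> 2"
  shows "a_seq (n - 1) dvd a_seq n"
  using a_seq_rec[OF assms] by simp

lemma b_seq_pos_exact:
  assumes "n \<ge> 2"
  shows "b_seq n > 0" and "a_seq n = a_seq (n - 1) * (b_seq n + 1)"
proof -
  have pos: "a_seq (n - 1) > 0" using assms by (intro a_seq_pos) simp
  obtain k where k: "lcm n (a_seq (n - 1)) = a_seq (n - 1) * k"
    using dvd_lcm2 by blast
  have "k > 0" using k pos assms by (intro Nat.gr0I) auto
  have a: "a_seq n = a_seq (n - 1) * (k + 1)"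
    using a_seq_rec[OF assms] k by simp
  then have "b_seq n = k"
    unfolding b_seq_def using pos by (metis add_diff_cancel_right' nonzero_mult_div_cancel_left less_numeral_extra(3))
  then show "b_seq n > 0" and "a_seq n = a_seq (n - 1) * (b_seq n + 1)"
    using a \<open>k > 0\<close> by simp_all
qed

lemma b_seq_of_nat:
  assumes "n \<ge> 2"
  shows "(of_nat (b_seq n) :: rat) = of_nat (a_seq n) / of_nat (a_seq (n - 1)) - 1"
proof -
  have "a_seq (n - 1) > 0" using assms by (intro a_seq_pos) simp
  then show ?thesis
    by (subst b_seq_pos_exact(2)[OF assms]) (simp add: field_simps)
qed

end

theory Submission
  imports Defs
begin

text \<open>
  Since \<open>lcm(n, a) = a \<cdot> n / gcd(n, a)\<close>, one has \<open>b\<^sub>n = n / gcd(n, a\<^sub>n\<^sub>-\<^sub>1)\<close>, while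
  \<open>a\<^sub>n\<^sub>-\<^sub>1\<close> is the product of all \<open>b\<^sub>m + 1\<close> with \<open>2 \<le> m < n\<close>.  With \<open>P\<close> the largest prime factor
  of \<open>n\<close>, it therefore suffices that \<open>n\<close> divides \<open>P \<cdot> a\<^sub>n\<^sub>-\<^sub>1\<close>: then \<open>b\<^sub>n\<close> divides the prime \<open>P\<close>.

  The proof is a strong induction on \<open>n\<close>.  As long as the earlier \<open>b\<^sub>m\<close> are \<open>1\<close> or prime factors
  of \<open>m\<close>, no prime \<open>q \<noteq> 3\<close> divides one of the numbers \<open>b\<^sub>m + 1\<close> with \<open>m < q\<close>, so \<open>b\<^sub>q = q\<close>
  (lemma \<open>b_seq_prime\<close>).  Hence every prime \<open>q < n\<close> with \<open>q \<equiv> -1\<close> modulo \<open>p\<close>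
  contributes a factor \<open>b\<^sub>q + 1 = q + 1\<close> divisible by \<open>p\<close>; the exception \<open>b\<^sub>3 = 1\<close> is harmless,
  because \<open>3 \<equiv> -1\<close> only modulo \<open>p = 2\<close> and \<open>b\<^sub>3 + 1 = 2\<close>.  The assumed lower bound for the number
  of such primes then gives \<open>p^k dvd a\<^sub>n\<^sub>-\<^sub>1\<close> whenever \<open>p^(k+1) \<le> n\<close> (lemma
  \<open>prime_power_dvd_a_seq\<close>).

  This is exactly what is needed.  If \<open>p^e\<close> exactly divides \<open>n\<close> and \<open>p < P\<close>, then
  \<open>n \<ge> p^e \<cdot> P \<ge> p^(e+1)\<close>, so \<open>p^e\<close> divides \<open>a\<^sub>n\<^sub>-\<^sub>1\<close>; if \<open>p = P\<close>, then \<open>n \<ge> P^e\<close> only yields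
  \<open>P^(e-1)\<close>, and the missing factor is the \<open>P\<close> in \<open>P \<cdot> a\<^sub>n\<^sub>-\<^sub>1\<close>.
\<close>

lemma a_seq_eq_prod:
  assumes "n \<ge> 1"
  shows "a_seq n = (\<Prod>m\<in>{2..n}. b_seq m + 1)"
  using assms
proof (induction n rule: nat_induct_at_least)
  case base
  show ?case by simp
next
  case (Suc n)
  have "a_seq (Suc n) = a_seq n * (b_seq (Suc n) + 1)"
    using b_seq_pos_exact(2)[of "Suc n"] Suc.hyps by simp
  moreover have "{2..Suc n} = insert (Suc n) {2..n}"
    using Suc.hyps by auto
  ultimately show ?case
    using Suc.IH by (simp add: mult.commute)
qed

lemma b_seq_times_gcd:
  assumes "n \<ge> 2"
  shows "b_seq n * gcd n (a_seq (n - 1)) = n"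
proof -
  let ?a = "a_seq (n - 1)"
  have pos: "?a > 0" using assms by (intro a_seq_pos) simp
  have "lcm n ?a = ?a * b_seq n"
    using a_seq_rec[OF assms] b_seq_pos_exact(2)[OF assms] by simp
  then have "?a * n = ?a * (b_seq n * gcd n ?a)"
    using prod_gcd_lcm_nat[of n ?a] by (simp add: mult_ac)
  then show ?thesis using pos by auto
qed

text \<open>
  A prime \<open>q\<close> dividing \<open>b\<^sub>m + 1\<close> with \<open>m < q\<close> would need \<open>b\<^sub>m = q - 1\<close>, since \<open>b\<^sub>m \<le> m\<close>; two
  consecutive numbers are both prime only for \<open>q = 3\<close>.  There \<open>b\<^sub>2 = 2\<close> does spoil the conclusion.
\<close>

lemma b_seq_prime:
  assumes q: "prime q" "q \<noteq> 3"
    and small: "\<And>m. 2 \<le> m \<Longrightarrow> m < q \<Longrightarrow> b_seq m = 1 \<or> b_seq m \<in> prime_factors m"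
  shows "b_seq q = q"
proof -
  have q2: "q \<ge> 2" using q(1) by (rule prime_ge_2_nat)
  have "\<not> q dvd a_seq (q - 1)"
  proof
    assume "q dvd a_seq (q - 1)"
    then have "q dvd (\<Prod>m\<in>{2..q - 1}. b_seq m + 1)"
      using a_seq_eq_prod[of "q - 1"] q2 by simp
    then obtain m where m: "2 \<le> m" "m < q" "q dvd b_seq m + 1"
      using q(1) by (auto simp: prime_dvd_prod_iff)
    show False
    proof (cases "b_seq m = 1")
      case True
      then have "q \<le> 2" using dvd_imp_le[OF m(3)] by simp
      then show False using m by simp
    next
      case False
      then have r: "prime (b_seq m)" "b_seq m \<le> m"
        using small[OF m(1,2)] m(1) by (auto simp: in_prime_factors_iff dvd_imp_le)
      have "q \<le> b_seq m + 1" using dvd_imp_le[OF m(3)] by simp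
      then have eq: "q = b_seq m + 1" using r(2) m(2) by simp
      have "q \<noteq> 2" using m by simp
      then have "odd q" using q(1) primes_dvd_imp_eq two_is_prime_nat by blast
      then have "even (b_seq m)" using eq by simp
      then have "b_seq m = 2"
        using r(1) primes_dvd_imp_eq two_is_prime_nat by metis
      then show False using eq q(2) by simp
    qed
  qed
  then have "gcd q (a_seq (q - 1)) = 1"
    using q(1) by (metis prime_imp_coprime coprime_iff_gcd_eq_1)
  then show ?thesis using b_seq_times_gcd[OF q2] by simp
qed

lemma b_seq_3: "b_seq 3 = 1"
proof -
  have "a_seq 2 = 3" using a_seq_rec[of 2] by simp
  then show ?thesis using b_seq_times_gcd[of 3] by simp
qed

text \<open>
  The bound \<open>p^(k+1) \<le> n\<close> puts all the counted primes below \<open>n\<close>, so each supplies its own factor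
  of the product for \<open>a\<^sub>n\<^sub>-\<^sub>1\<close>.
\<close>

lemma prime_power_dvd_a_seq:
  assumes many: "k \<ge> 1 \<Longrightarrow> prime_count_ap (p ^ (k + 1)) p (p - 1) \<ge> k"
    and p: "prime p" and le: "p ^ (k + 1) \<le> n"
    and small: "\<And>m. 2 \<le> m \<Longrightarrow> m < n \<Longrightarrow> b_seq m = 1 \<or> b_seq m \<in> prime_factors m"
  shows "p ^ k dvd a_seq (n - 1)"
proof (cases "k = 0")
  case False
  define S where "S = {q. prime q \<and> q < p ^ (k + 1) \<and> [q = p - 1] (mod p)}"
  have S_sub: "S \<subseteq> {2..n - 1}"
    using le by (auto simp: S_def dest: prime_ge_2_nat)
  have dvd: "p dvd b_seq q + 1" if "q \<in> S" for q
  proof -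
    have "[q + 1 = p - 1 + 1] (mod p)"
      using that unfolding S_def by (blast intro: cong_add cong_refl)
    then have pq: "p dvd q + 1"
      using prime_gt_0_nat[OF p] by (simp add: cong_0_iff[symmetric] cong_def)
    show ?thesis
    proof (cases "q = 3")
      case True
      \<comment> \<open>Here \<open>b\<^sub>q \<noteq> q\<close>, but \<open>p\<close> divides \<open>q + 1 = 4\<close>, so \<open>p = 2 = b\<^sub>3 + 1\<close>.\<close>
      then have "p dvd 2 ^ 2" using pq by simp
      then have "p dvd 2" using p prime_dvd_power by blast
      then show ?thesis using True by (simp add: b_seq_3 numeral_2_eq_2)
    next
      case False
      have "b_seq q = q"
        using that False le by (intro b_seq_prime small) (auto simp: S_def)
      then show ?thesis using pq by simp
    qed
  qed
  have "k \<le> card S"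
    using many False by (simp add: S_def prime_count_ap_def)
  then have "p ^ k dvd (\<Prod>q\<in>S. p)" by (simp add: le_imp_power_dvd)
  also have "\<dots> dvd (\<Prod>q\<in>S. b_seq q + 1)"
    using dvd by (intro prod_dvd_prod)
  also have "\<dots> dvd (\<Prod>q\<in>{2..n - 1}. b_seq q + 1)"
    using S_sub by (intro prod_dvd_prod_subset) auto
  also have "\<dots> = a_seq (n - 1)"
  proof -
    have "p ^ 2 \<le> p ^ (k + 1)"
      using False p by (intro power_increasing) (auto dest: prime_gt_0_nat)
    moreover have "2 ^ 2 \<le> p ^ 2"
      using p by (intro power_mono prime_ge_2_nat) auto
    ultimately have "n \<ge> 2" using le by simp
    then show ?thesis using a_seq_eq_prod[of "n - 1"] by simp
  qed
  finally show ?thesis .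
qed simp

lemma Max_prime_factors:
  fixes n :: nat
  assumes "n \<ge> 2"
  shows "Max (prime_factors n) \<in> prime_factors n"
proof -
  obtain p where "prime p" "p dvd n"
    using assms prime_factor_nat[of n] by auto
  then have "prime_factors n \<noteq> {}"
    using assms by (auto simp: prime_factors_dvd)
  then show ?thesis by (intro Max_in) auto
qed

text \<open>
  The divisibility \<open>n dvd P \<cdot> a\<^sub>n\<^sub>-\<^sub>1\<close> is checked one prime at a time.  The presence of a larger prime
  factor \<open>P\<close> of \<open>n\<close> is what gains one power of \<open>p\<close> in the comparison of \<open>n\<close> with \<open>p^e\<close>.
\<close>

lemma b_seq_eq_1_or_Max_prime_factors:
  assumes many: "\<And>p k. prime p \<Longrightarrow> k \<ge> 1 \<Longrightarrow> prime_count_ap (p ^ (k + 1)) p (p - 1) \<ge> k"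
    and "n \<ge> 2"
  shows "b_seq n = 1 \<or> b_seq n = Max (prime_factors n)"
  using \<open>n \<ge> 2\<close>
proof (induction n rule: less_induct)
  case (less n)
  define P where "P = Max (prime_factors n)"
  let ?a = "a_seq (n - 1)"
  have P: "prime P" "P dvd n"
    using Max_prime_factors[OF less.prems] by (auto simp: P_def)
  have small: "b_seq m = 1 \<or> b_seq m \<in> prime_factors m" if "2 \<le> m" "m < n" for m
    using less.IH[OF that(2,1)] Max_prime_factors[OF that(1)] by auto
  have apos: "?a > 0" using less.prems by (intro a_seq_pos) simp
  have power_dvd: "p ^ k dvd ?a" if "prime p" "p ^ (k + 1) \<le> n" for p k
    using prime_power_dvd_a_seq[OF many[OF that(1)] that small] by blast

  have "n dvd P * ?a"
  proof (rule multiplicity_le_imp_dvd)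
    show "n \<noteq> 0" using less.prems by simp
    fix p :: nat assume p: "prime p"
    define e where "e = multiplicity p n"
    have e: "p ^ e dvd n" by (simp add: e_def multiplicity_dvd)
    have "p ^ e dvd P * ?a"
    proof (cases "e = 0")
      case False
      have "p dvd n"
        using e False by (meson dvd_power dvd_trans neq0_conv)
      then have "p \<in> prime_factors n"
        using p less.prems by (simp add: prime_factors_dvd)
      then have "p \<le> P" by (simp add: P_def)
      show ?thesis
      proof (cases "p = P")
        case True
        have eq: "p ^ e = p * p ^ (e - 1)"
          using False by (simp add: power_eq_if)
        have "p ^ (e - 1) dvd ?a"
          using dvd_imp_le[OF e] less.prems False by (intro power_dvd[OF p]) simp
        then show ?thesis unfolding eq using True by simp
      next
        case False
        have "coprime (p ^ e) P"
          using False p P(1) by (simp add: primes_coprime)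
        then have "p ^ e * P dvd n"
          using e P(2) by (intro divides_mult)
        have "p ^ (e + 1) \<le> p ^ e * P"
          using \<open>p \<le> P\<close> by simp
        also have "\<dots> \<le> n"
          using \<open>p ^ e * P dvd n\<close> less.prems by (intro dvd_imp_le) auto
        finally have "p ^ e dvd ?a"
          by (rule power_dvd[OF p])
        then show ?thesis by simp
      qed
    qed simp
    moreover have "P * ?a \<noteq> 0"
      using apos prime_gt_0_nat[OF P(1)] by simp
    ultimately show "multiplicity p n \<le> multiplicity p (P * ?a)"
      using p unfolding e_def by (intro multiplicity_geI) auto
  qed
  then have "n dvd P * gcd n ?a"
    by (simp add: gcd_mult_distrib_nat)
  then have "b_seq n * gcd n ?a dvd P * gcd n ?a"
    using b_seq_times_gcd[OF less.prems] by simp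
  then have "b_seq n dvd P" using apos by simp
  then show ?case
    using P(1) by (auto simp: prime_nat_iff P_def)
qed

theorem proposition4:
  assumes "\<And>(p :: nat) (k :: nat). prime p \<Longrightarrow> k \<ge> 1 \<Longrightarrow> prime_count_ap (p ^ (k + 1)) p (p - 1) \<ge> k"
  shows "(\<forall>n\<ge>2. b_seq n = 1 \<or> b_seq n = Max (prime_factors n)) \<and>
         (\<forall>n\<ge>2. b_seq n = 1 \<or> prime (b_seq n))"
proof -
  have Max_factor: "b_seq n = 1 \<or> b_seq n = Max (prime_factors n)" if "n \<ge> 2" for n
    using b_seq_eq_1_or_Max_prime_factors assms that by blast
  moreover have "b_seq n = 1 \<or> prime (b_seq n)" if "n \<ge> 2" for n
    using Max_factor[OF that] in_prime_factors_imp_prime[OF Max_prime_factors[OF that]]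
    by (elim disjE) simp_all
  ultimately show ?thesis by blast
qed

end
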